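(* There exists a continuous map $f\colon [0,1]\to[0,1]$ of zero topological entropy which is chaotic in the sense of Wiggins.
   Context: Let $X$ be a metric space with distance $d$ and $T\colon X\to X$ continuous. $T$ is transitive if for all nonempty open subsets $U,V$ of $X$ there is an integer $n\ge 0$ with $T^{-n}(U)\cap V\neq\emptyset$. $T$ is sensitive (has sensitive dependence to initial conditions) if there is $\delta>0$ such that for all $x\in X$ and all neighbourhoods $U$ of $x$ there exist $y\in U$ and $n\ge 0$ with $d(T^n(x),T^n(y))\ge\delta$. A subset $Y\subset X$ is invariant if $T(Y)\subset Y$. $T$ is chaotic in the sense of Wiggins if there exists a nonempty closed invariant subset $Y\subset X$ such that the restriction $T|_Y\colon Y\to Y$ is transitive and sensitive. *)

theory Defs
  imports "HOL-Analysis.Analysis"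
begin

text \<open>
  A dynamical system is a set \<open>X\<close> in a metric space together with a function \<open>T\<close> on the whole type
  which is continuous on \<open>X\<close> and maps \<open>X\<close> into itself. The values of \<open>T\<close> outside \<open>X\<close> are
  irrelevant. On an invariant subset \<open>Y\<close> the iterates of the restriction of \<open>T\<close> to \<open>Y\<close> agree with
  \<open>T ^^ n\<close>, so a subsystem is described by the same \<open>T\<close> and the smaller carrier \<open>Y\<close>.
\<close>

definition transitive_map :: "'a::metric_space set \<Rightarrow> ('a \<Rightarrow> 'a) \<Rightarrow> bool" where
  "transitive_map X T \<longleftrightarrow>
     (\<forall>U V. openin (top_of_set X) U \<and> U \<noteq> {} \<and> openin (top_of_set X) V \<and> V \<noteq> {} \<longrightarrow>
        (\<exists>n::nat. (T ^^ n) -` U \<inter> V \<noteq> {}))"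

definition sensitive_map :: "'a::metric_space set \<Rightarrow> ('a \<Rightarrow> 'a) \<Rightarrow> bool" where
  "sensitive_map X T \<longleftrightarrow>
     (\<exists>\<delta>>0. \<forall>x\<in>X. \<forall>U. openin (top_of_set X) U \<and> x \<in> U \<longrightarrow>
        (\<exists>y\<in>U. \<exists>n::nat. dist ((T ^^ n) x) ((T ^^ n) y) \<ge> \<delta>))"

definition wiggins_chaotic :: "'a::metric_space set \<Rightarrow> ('a \<Rightarrow> 'a) \<Rightarrow> bool" where
  "wiggins_chaotic X T \<longleftrightarrow>
     (\<exists>Y. Y \<noteq> {} \<and> closedin (top_of_set X) Y \<and> T ` Y \<subseteq> Y \<and>
        transitive_map Y T \<and> sensitive_map Y T)"

text \<open>
  Topological entropy in Bowen's form, for a continuous self-map of a compact set \<open>X\<close>: the supremum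
  over \<open>\<epsilon> > 0\<close> of the exponential growth rate of the minimal cardinality of an
  \<open>(n, \<epsilon>)\<close>-spanning subset of \<open>X\<close>.
\<close>

definition spanning_set ::
  "'a::metric_space set \<Rightarrow> ('a \<Rightarrow> 'a) \<Rightarrow> nat \<Rightarrow> real \<Rightarrow> 'a set \<Rightarrow> bool" where
  "spanning_set X T n \<epsilon> F \<longleftrightarrow>
     F \<subseteq> X \<and> (\<forall>x\<in>X. \<exists>y\<in>F. \<forall>k<n. dist ((T ^^ k) x) ((T ^^ k) y) < \<epsilon>)"

definition spanning_number ::
  "'a::metric_space set \<Rightarrow> ('a \<Rightarrow> 'a) \<Rightarrow> nat \<Rightarrow> real \<Rightarrow> nat" where
  "spanning_number X T n \<epsilon> = Inf {card F | F. finite F \<and> spanning_set X T n \<epsilon> F}"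

definition topological_entropy :: "'a::metric_space set \<Rightarrow> ('a \<Rightarrow> 'a) \<Rightarrow> ereal" where
  "topological_entropy X T =
     (SUP \<epsilon>\<in>{0<..}. limsup (\<lambda>n. ereal (ln (real (spanning_number X T n \<epsilon>)) / real n)))"

text \<open>
  The infimum defining \<^const>\<open>spanning_number\<close> ranges over a nonempty set in the situation of
  interest, so the convention \<open>Inf {} = 0\<close> on the natural numbers plays no role.
\<close>

lemma finite_spanning_set_exists:
  fixes X :: "'a::metric_space set"
  assumes "compact X" and cont: "continuous_on X T" and inv: "T ` X \<subseteq> X" and "\<epsilon> > 0"
  shows "\<exists>F. finite F \<and> spanning_set X T n \<epsilon> F"
proof -
  have maps: "(T ^^ k) ` X \<subseteq> X" for k
    using inv by (induction k) auto
  have iter: "continuous_on X (T ^^ k)" for k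
  proof (induction k)
    case 0
    show ?case by (simp add: id_def)
  next
    case (Suc k)
    have "continuous_on X (T \<circ> (T ^^ k))"
      by (rule continuous_on_compose[OF Suc continuous_on_subset[OF cont maps]])
    then show ?case by simp
  qed
  define B where "B y = {x \<in> X. \<forall>k<n. dist ((T ^^ k) x) ((T ^^ k) y) < \<epsilon>}" for y
  have B: "openin (top_of_set X) (B y)" for y
  proof -
    have one: "openin (top_of_set X) {x \<in> X. (T ^^ k) x \<in> ball ((T ^^ k) y) \<epsilon>}" for k
      using continuous_openin_preimage_gen[OF iter open_ball, of k "(T ^^ k) y" \<epsilon>]
      by (simp add: vimage_def Int_def)
    have "B y = X \<inter> (\<Inter>k\<in>{..<n}. {x \<in> X. (T ^^ k) x \<in> ball ((T ^^ k) y) \<epsilon>})"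
      by (auto simp: B_def dist_commute)
    moreover have "openin (top_of_set X) (X \<inter> (\<Inter>k\<in>{..<m}. {x \<in> X. (T ^^ k) x \<in> ball ((T ^^ k) y) \<epsilon>}))" for m
    proof (induction m)
      case 0
      show ?case by simp
    next
      case (Suc m)
      have "X \<inter> (\<Inter>k\<in>{..<Suc m}. {x \<in> X. (T ^^ k) x \<in> ball ((T ^^ k) y) \<epsilon>}) =
            (X \<inter> (\<Inter>k\<in>{..<m}. {x \<in> X. (T ^^ k) x \<in> ball ((T ^^ k) y) \<epsilon>})) \<inter>
            {x \<in> X. (T ^^ m) x \<in> ball ((T ^^ m) y) \<epsilon>}"
        by (auto simp: lessThan_Suc)
      then show ?case by (simp only: openin_Int[OF Suc one])
    qed
    ultimately show ?thesis by (simp only:)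
  qed
  have cover: "X \<subseteq> (\<Union>y\<in>X. B y)"
    using \<open>\<epsilon> > 0\<close> by (auto simp: B_def)
  have "\<forall>C\<in>B ` X. openin (top_of_set X) C"
    using B by blast
  with cover obtain \<D> where D: "\<D> \<subseteq> B ` X" "finite \<D>" "X \<subseteq> \<Union>\<D>"
    using \<open>compact X\<close>[unfolded compact_eq_openin_cover, rule_format, of "B ` X"] by blast
  then obtain F where "F \<subseteq> X" "finite F" "\<D> = B ` F"
    by (meson finite_subset_image)
  with D have "spanning_set X T n \<epsilon> F"
    unfolding spanning_set_def B_def by blast
  with \<open>finite F\<close> show ?thesis by blast
qed

end

theory Submission
  imports Defs "HOL-Real_Asymp.Real_Asymp"
begin

text \<open>
  The map is the tent map \<open>x \<mapsto> 1 - \<bar>1 - 2 * x\<bar>\<close> truncated at the height \<open>h\<close> whose binary digits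
  form the Thue-Morse sequence. Since this sequence is lexicographically maximal among its shifts,
  each complemented if it starts with 1, the orbit of \<open>h\<close> never meets the interior of the plateau,
  and the self-similarity of the sequence makes \<open>h\<close> recurrent but not periodic. Hence the truncated
  map is transitive on the closure of this orbit. It is sensitive there because distances double
  until two points are separated by the plateau, which has positive length.

  For the entropy, assign to each point the sequence of orientations (signs of slope) of the
  iterates. This assignment is lexicographically monotone, so from the second term on every shift
  is bounded by the Thue-Morse sequence. Such sequences are desubstituted by \<open>0 \<mapsto> 01, 1 \<mapsto> 10\<close> after a
  constant and an alternating prefix, so the number \<open>q n\<close> of their words of length \<open>n\<close> satisfies
  \<open>q n \<le> 2 * (n + 1)\<^sup>2 * q ((n + 1) div 2)\<close> and grows subexponentially.
\<close>

section \<open>The Thue-Morse sequence\<close>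

text \<open>The value is the parity of the number of ones in the binary expansion of
  \<open>n\<close>.\<close>

fun thue_morse :: "nat \<Rightarrow> bool" where
  "thue_morse n = (if n = 0 then False else thue_morse (n div 2) \<noteq> odd n)"

declare thue_morse.simps [simp del]

lemma thue_morse_0 [simp]: "\<not> thue_morse 0"
  by (simp add: thue_morse.simps)

lemma thue_morse_double [simp]: "thue_morse (2 * n) = thue_morse n"
  by (cases "n = 0") (simp, subst thue_morse.simps, simp)

lemma thue_morse_Suc_double [simp]: "thue_morse (Suc (2 * n)) = (\<not> thue_morse n)"
  by (subst thue_morse.simps) simp

lemma thue_morse_small [simp]:
  "thue_morse 1" "thue_morse (Suc 0)" "thue_morse 2" "\<not> thue_morse 3" "thue_morse 4"
  "\<not> thue_morse 5" "\<not> thue_morse 6"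
  by (simp_all add: thue_morse.simps)

text \<open>The binary digits of \<open>m * 2 ^ j + i\<close> are those of \<open>m\<close> followed
  by those of \<open>i\<close>, padded to length \<open>j\<close>, so the two digit-sum parities
  add.\<close>

lemma thue_morse_block:
  "i < 2 ^ j \<Longrightarrow> thue_morse (m * 2 ^ j + i) = (thue_morse m \<noteq> thue_morse i)"
proof (induction j arbitrary: i)
  case 0
  then show ?case by simp
next
  case (Suc j)
  obtain l where l: "i = 2 * l \<or> i = Suc (2 * l)"
    by (metis oddE evenE Suc_eq_plus1)
  then have "l < 2 ^ j" using Suc.prems by auto
  note IH = Suc.IH[OF this]
  have "m * 2 ^ Suc j + 2 * l = 2 * (m * 2 ^ j + l)"
    "m * 2 ^ Suc j + Suc (2 * l) = Suc (2 * (m * 2 ^ j + l))" by simp_all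
  with l IH show ?case by (metis thue_morse_double thue_morse_Suc_double)
qed

text \<open>The sequence \<open>e\<close> of changes is true at even places and negates itself from
  \<open>n\<close> to \<open>2 * n + 1\<close>, so an even period can be halved and an odd one is
  impossible. Changes are used because they tell on which side of \<open>1/2\<close> the orbit of
  \<open>height\<close> lies.\<close>

lemma thue_morse_not_eventually_periodic:
  assumes "k > 0"
  shows "\<exists>n\<ge>i. (thue_morse n \<noteq> thue_morse (Suc n)) \<noteq>
                 (thue_morse (n + k) \<noteq> thue_morse (Suc (n + k)))"
  using assms
proof (induction k rule: less_induct)
  case (less k)
  define e where "e n \<longleftrightarrow> thue_morse n \<noteq> thue_morse (Suc n)" for n
  have even: "e (2 * n)" for n by (simp add: e_def)
  have odd: "e (Suc (2 * n)) = (\<not> e n)" for n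
    using thue_morse_double[of "Suc n"] by (simp add: e_def del: thue_morse_double)
  show ?case
  proof (cases "even k")
    case True
    then obtain k' where k': "k = 2 * k'" by blast
    with less.prems less.IH[of k'] obtain n where n: "n \<ge> i" "e n \<noteq> e (n + k')"
      unfolding e_def by auto
    have "e (Suc (2 * n)) \<noteq> e (Suc (2 * n) + k)"
      using n odd[of n] odd[of "n + k'"] by (simp add: k')
    with n show ?thesis unfolding e_def[symmetric] by (intro exI[of _ "Suc (2 * n)"]) auto
  next
    case False
    then obtain k' where k': "k = Suc (2 * k')" by (metis oddE Suc_eq_plus1)
    \<comment> \<open>There is no change at \<open>4 * i + 1\<close>, but adding an odd
      \<open>k\<close> leads to an even place, where there is one.\<close>
    have "e (Suc (2 * (2 * i)) + k)" using even[of "2 * i + k' + 1"] by (simp add: k')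
    moreover have "\<not> e (Suc (2 * (2 * i)))" using even odd by blast
    ultimately show ?thesis
      unfolding e_def[symmetric] by (intro exI[of _ "Suc (2 * (2 * i))"]) auto
  qed
qed

section \<open>Sequences dominated by the Thue-Morse sequence\<close>

text \<open>Lexicographic order with \<open>False\<close> below \<open>True\<close>, stated so that
  no first difference has to be named.\<close>

definition lex_le :: "(nat \<Rightarrow> bool) \<Rightarrow> (nat \<Rightarrow> bool) \<Rightarrow> bool" where
  "lex_le s t \<longleftrightarrow> (\<forall>k. (\<forall>i<k. s i = t i) \<longrightarrow> s k \<longrightarrow> t k)"

text \<open>The shift, complemented if it starts with \<open>True\<close>. On binary digits this is
  an iterate of the tent map.\<close>

definition fold_shift :: "nat \<Rightarrow> (nat \<Rightarrow> bool) \<Rightarrow> nat \<Rightarrow> bool" where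
  "fold_shift k s i \<longleftrightarrow> s (k + i) \<noteq> s k"

definition dominated :: "(nat \<Rightarrow> bool) \<Rightarrow> bool" where
  "dominated s \<longleftrightarrow> (\<forall>k. lex_le (fold_shift k s) thue_morse)"

lemma fold_shift_fold_shift: "fold_shift j (fold_shift k s) = fold_shift (k + j) s"
  by (auto simp: fold_shift_def add.assoc)

lemma fold_shift_at_0 [simp]: "\<not> fold_shift k s 0"
  by (simp add: fold_shift_def)

lemma dominatedD:
  assumes "dominated s" "\<forall>i<m. (s (k + i) \<noteq> s k) = thue_morse i" "s (k + m) \<noteq> s k"
  shows "thue_morse m"
  using assms unfolding dominated_def lex_le_def fold_shift_def by blast

text \<open>For even \<open>k\<close>, restriction to even places halves both \<open>k\<close> and
  \<open>m\<close>. For odd \<open>k\<close>, the letters at \<open>k + 1\<close> and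
  \<open>k + 2\<close> form a pair and differ, whereas letters 1 and 2 of the Thue-Morse sequence
  agree; hence the first difference comes at place 1 or 2, where that sequence is
  \<open>True\<close>.\<close>

lemma dominated_thue_morse: "dominated thue_morse"
proof -
  have "thue_morse m"
    if "\<forall>i<m. (thue_morse (k + i) \<noteq> thue_morse k) = thue_morse i"
      "thue_morse (k + m) \<noteq> thue_morse k" for k m
    using that
  proof (induction m arbitrary: k rule: less_induct)
    case (less m)
    have m0: "m \<noteq> 0" using less.prems(2) by (intro notI) simp
    show ?case
    proof (cases "even k")
      case True
      then obtain k' where k': "k = 2 * k'" by blast
      have agree: "(thue_morse (k' + i) \<noteq> thue_morse k') = thue_morse i" if "2 * i < m" for i
        using less.prems(1)[rule_format, OF that] thue_morse_double[of "k' + i"]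
        by (simp add: k' del: thue_morse_double) (simp add: distrib_left)
      show ?thesis
      proof (cases "even m")
        case True
        then obtain m' where m': "m = 2 * m'" by blast
        have "thue_morse m'"
        proof (rule less.IH)
          show "m' < m" using m0 m' by simp
          show "\<forall>i<m'. (thue_morse (k' + i) \<noteq> thue_morse k') = thue_morse i"
            using agree m' by simp
          show "thue_morse (k' + m') \<noteq> thue_morse k'"
            using less.prems(2) unfolding m' k' by (metis distrib_left thue_morse_double)
        qed
        then show ?thesis by (simp add: m')
      next
        case False
        then obtain m' where m': "m = Suc (2 * m')" by (metis oddE Suc_eq_plus1)
        have "thue_morse (k + m) = (\<not> thue_morse (k' + m'))"
          using thue_morse_Suc_double[of "k' + m'"]
          by (simp add: k' m' distrib_left del: thue_morse_Suc_double)
        then show ?thesis using agree[of m'] less.prems(2) by (simp add: m' k')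
      qed
    next
      case False
      then obtain k' where k': "k = Suc (2 * k')" by (metis oddE Suc_eq_plus1)
      show ?thesis
      proof (rule ccontr)
        assume "\<not> thue_morse m"
        then have "m \<noteq> 1" "m \<noteq> 2" by auto
        then have "m > 2" using m0 by simp
        then have "thue_morse (k + 1) = thue_morse (k + 2)"
          using less.prems(1)[rule_format, of 1] less.prems(1)[rule_format, of 2] by auto
        then show False
          using thue_morse_double[of "Suc k'"] thue_morse_Suc_double[of "Suc k'"]
          by (simp add: k' del: thue_morse_double thue_morse_Suc_double)
      qed
    qed
  qed
  then show ?thesis unfolding dominated_def lex_le_def fold_shift_def by blast
qed

text \<open>After a repeated letter following a change, a dominated sequence splits into the pairs
  \<open>01\<close> and \<open>10\<close>: the initial segment \<open>0110100\<close> of the Thue-Morse sequence forces the next repetition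
  to occur two or four places later.\<close>

lemma dominated_pairs:
  assumes "dominated s" "s p \<noteq> s (p + 1)" "s (p + 1) = s (p + 2)"
  shows "s (p + 2 * k) \<noteq> s (p + 2 * k + 1)"
  using assms(2,3)
proof (induction k arbitrary: p rule: less_induct)
  case (less k)
  let ?t = "\<lambda>i. s (p + i) \<noteq> s p"
  have t: "\<not> ?t 0" "?t 1" "?t 2" using less.prems by auto
  have bounded: "\<not> ?t m" if "\<forall>i<m. ?t i = thue_morse i" "\<not> thue_morse m" for m
    using dominatedD[OF assms(1) that(1)] that(2) by blast
  have small: "i < 3 \<longleftrightarrow> i = 0 \<or> i = 1 \<or> i = 2" "i < 5 \<longleftrightarrow> i = 0 \<or> i = 1 \<or> i = 2 \<or> i = 3 \<or> i = 4"
    "i < 6 \<longleftrightarrow> i = 0 \<or> i = 1 \<or> i = 2 \<or> i = 3 \<or> i = 4 \<or> i = 5" for i :: nat by auto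
  have t3: "\<not> ?t 3" using t by (intro bounded) (auto simp: small)
  have t5: "\<not> ?t 5" if "?t 4" using t t3 that by (intro bounded) (auto simp: small)
  have t6: "\<not> ?t 6" if "?t 4" using t t3 t5[OF that] that by (intro bounded) (auto simp: small)
  consider "k = 0" | "k = 1" | "k \<ge> 2" by linarith
  then show ?case
  proof cases
    case 1
    then show ?thesis using less.prems by simp
  next
    case 2
    then show ?thesis using t t3 by (simp add: numeral_3_eq_3)
  next
    case 3
    \<comment> \<open>Up to complement the word at \<open>p\<close> starts with 0110. If 1 follows,
      it extends to 0110100 and the pattern 100 recurs at \<open>p + 4\<close>; otherwise it is
      01100 and the pattern recurs at \<open>p + 2\<close>.\<close>
    show ?thesis
    proof (cases "?t 4")
      case True
      have "s (p + 4 + 2 * (k - 2)) \<noteq> s (p + 4 + 2 * (k - 2) + 1)"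
        using 3 True t5 t6 by (intro less.IH) (auto simp: eval_nat_numeral)
      moreover have "p + 4 + 2 * (k - 2) = p + 2 * k" using 3 by simp
      ultimately show ?thesis by metis
    next
      case False
      have "s (p + 2 + 2 * (k - 1)) \<noteq> s (p + 2 + 2 * (k - 1) + 1)"
        using 3 False t t3 by (intro less.IH) (auto simp: eval_nat_numeral)
      moreover have "p + 2 + 2 * (k - 1) = p + 2 * k" using 3 by simp
      ultimately show ?thesis by metis
    qed
  qed
qed

text \<open>The Thue-Morse sequence is fixed by 0 -> 01, 1 -> 10, so agreement of \<open>m\<close>
  letters of the thinned sequence amounts to agreement of \<open>2 * m\<close> letters of
  \<open>s\<close>.\<close>

lemma dominated_unpair:
  assumes "dominated s" and pairs: "\<And>k. s (p + 2 * k) \<noteq> s (p + 2 * k + 1)"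
  shows "dominated (\<lambda>k. s (p + 2 * k))"
  unfolding dominated_def lex_le_def fold_shift_def
proof (intro allI impI)
  fix k m
  assume agree: "\<forall>i<m. (s (p + 2 * (k + i)) \<noteq> s (p + 2 * k)) = thue_morse i"
    and differ: "s (p + 2 * (k + m)) \<noteq> s (p + 2 * k)"
  have "thue_morse (2 * m)"
  proof (rule dominatedD[OF assms(1), of _ "p + 2 * k"])
    show "\<forall>i<2 * m. (s (p + 2 * k + i) \<noteq> s (p + 2 * k)) = thue_morse i"
    proof (intro allI impI)
      fix i assume "i < 2 * m"
      then obtain l where l: "i = 2 * l \<or> i = Suc (2 * l)" "l < m"
        by (metis Suc_eq_plus1 less_mult_imp_div_less mult.commute odd_two_times_div_two_succ
            even_two_times_div_two)
      have "p + 2 * k + 2 * l = p + 2 * (k + l)"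
        "p + 2 * k + Suc (2 * l) = p + 2 * (k + l) + 1" by simp_all
      with l agree pairs[of "k + l"]
      show "(s (p + 2 * k + i) \<noteq> s (p + 2 * k)) = thue_morse i"
        by (metis thue_morse_double thue_morse_Suc_double)
    qed
    show "s (p + 2 * k + 2 * m) \<noteq> s (p + 2 * k)"
      using differ by (simp add: algebra_simps)
  qed
  then show "thue_morse m" by simp
qed

section \<open>Counting words of dominated sequences\<close>

definition dominated_words :: "nat \<Rightarrow> bool list set" where
  "dominated_words n = {map s [0..<n] | s. dominated s}"

lemma finite_dominated_words: "finite (dominated_words n)"
proof (rule finite_subset)
  show "dominated_words n \<subseteq> {w. set w \<subseteq> UNIV \<and> length w = n}"
    by (auto simp: dominated_words_def)
qed (rule finite_lists_length_eq, simp)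

lemma dominated_words_nonempty: "dominated_words n \<noteq> {}"
  using dominated_thue_morse by (auto simp: dominated_words_def)

text \<open>A dominated word consists of a constant part of length \<open>i\<close>, an alternating part up to
  position \<open>j\<close>, and the image of a shorter dominated word under \<open>0 \<mapsto> 01, 1 \<mapsto> 10\<close>.\<close>

definition assemble :: "nat \<Rightarrow> bool \<Rightarrow> nat \<Rightarrow> nat \<Rightarrow> bool list \<Rightarrow> bool list" where
  "assemble n c i j w = map (\<lambda>k. if j \<le> k then w ! ((k - j) div 2) \<noteq> odd (k - j)
                                 else if k < i then c else c \<noteq> even (k - i)) [0..<n]"

lemma dominated_word_assemble:
  assumes "dominated s"
  obtains c i j w where "i \<le> n" "j \<le> n" "w \<in> dominated_words ((n + 1) div 2)"
    "map s [0..<n] = assemble n c i j w"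
proof -
  \<comment> \<open>A filler word for the cases where no paired part begins before
    \<open>n\<close>.\<close>
  obtain w0 where w0: "w0 \<in> dominated_words ((n + 1) div 2)"
    using dominated_words_nonempty by blast
  define c where "c = s 0"
  show thesis
  proof (cases "\<forall>k<n. s k = c")
    case True
    then have "map s [0..<n] = assemble n c n n w0"
      by (auto simp: assemble_def)
    with w0 show thesis by (intro that[of n n]) auto
  next
    case False
    define i where "i = (LEAST k. s k \<noteq> c)"
    have i: "s i \<noteq> c" "i < n"
      using False LeastI[of "\<lambda>k. s k \<noteq> c"] Least_le[of "\<lambda>k. s k \<noteq> c"]
      unfolding i_def by (blast, metis (mono_tags, lifting) le_less_trans)
    have const: "s k = c" if "k < i" for k
      using not_less_Least that unfolding i_def by blast
    have alternate: "s k = (c \<noteq> even (k - i))"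
      if "i \<le> k" "\<forall>l. i \<le> l \<and> l < k \<longrightarrow> s l \<noteq> s (Suc l)" for k
      using that
    proof (induction k rule: dec_induct)
      case base
      then show ?case using i by auto
    next
      case (step k)
      then show ?case by (auto simp: Suc_diff_le)
    qed
    show thesis
    proof (cases "\<forall>l. i \<le> l \<and> Suc l < n \<longrightarrow> s l \<noteq> s (Suc l)")
      case True
      then have "s k = (c \<noteq> even (k - i))" if "i \<le> k" "k < n" for k
        using that by (intro alternate) auto
      then have "map s [0..<n] = assemble n c i n w0"
        unfolding assemble_def by (intro map_cong refl) (use const in auto)
      with w0 i show thesis by (intro that[of i n]) auto
    next
      case False
      define q where "q = (LEAST l. i \<le> l \<and> s l = s (Suc l))"
      have q: "i \<le> q" "s q = s (Suc q)" "q < n"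
        using False LeastI[of "\<lambda>l. i \<le> l \<and> s l = s (Suc l)"]
          Least_le[of "\<lambda>l. i \<le> l \<and> s l = s (Suc l)"]
        unfolding q_def by (blast, blast, meson Suc_lessD le_less_trans)
      have least: "s l \<noteq> s (Suc l)" if "i \<le> l" "l < q" for l
        using not_less_Least that unfolding q_def by blast
      \<comment> \<open>The pairs start one place before the first repetition \<open>q\<close>. The
        change required there comes from the end of the constant part if \<open>q = i\<close>, and
        from the minimality of \<open>q\<close> otherwise.\<close>
      have "i > 0" using i by (intro gr0I) (auto simp: c_def)
      then obtain j where j: "q = Suc j" using q by (cases q) auto
      have "s j \<noteq> s (j + 1)"
      proof (cases "i = q")
        case True
        then show ?thesis using i const[of j] j by auto
      next
        case False
        then show ?thesis using least[of j] q j by auto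
      qed
      then have pairs: "s (j + 2 * k) \<noteq> s (j + 2 * k + 1)" for k
        using q j by (intro dominated_pairs assms) auto
      let ?u = "\<lambda>k. s (j + 2 * k)"
      let ?w = "map ?u [0..<(n + 1) div 2]"
      have w: "?w \<in> dominated_words ((n + 1) div 2)"
        using dominated_unpair[OF assms pairs] unfolding dominated_words_def by blast
      have tail: "s k = (?w ! ((k - j) div 2) \<noteq> odd (k - j))" if "j \<le> k" "k < n" for k
      proof -
        \<comment> \<open>Rounding up accounts for a last pair that is cut off at
          \<open>n\<close>.\<close>
        have "(k - j) div 2 < (n + 1) div 2" using that by linarith
        then have eq: "?w ! ((k - j) div 2) = s (j + 2 * ((k - j) div 2))" by simp
        show ?thesis
        proof (cases "even (k - j)")
          case True
          then show ?thesis unfolding eq using that by simp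
        next
          case False
          then have "j + 2 * ((k - j) div 2) + 1 = k" using that by presburger
          then show ?thesis unfolding eq using pairs[of "(k - j) div 2"] False by auto
        qed
      qed
      have middle: "s k = (c \<noteq> even (k - i))" if "i \<le> k" "k < j" for k
        using that least j by (intro alternate) auto
      have "map s [0..<n] = assemble n c i j ?w"
        unfolding assemble_def
        by (intro map_cong refl) (use const middle tail in \<open>auto simp del: nth_map\<close>)
      with w i q j show thesis by (intro that[of i j]) auto
    qed
  qed
qed

lemma card_dominated_words_half:
  "card (dominated_words n) \<le> 2 * (n + 1)\<^sup>2 * card (dominated_words ((n + 1) div 2))"
proof -
  let ?P = "(UNIV :: bool set) \<times> {..n} \<times> {..n} \<times> dominated_words ((n + 1) div 2)"
  have "dominated_words n \<subseteq> (\<lambda>(c, i, j, w). assemble n c i j w) ` ?P"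
  proof
    fix v assume "v \<in> dominated_words n"
    then obtain s where "dominated s" "v = map s [0..<n]" by (auto simp: dominated_words_def)
    then obtain c i j w where "i \<le> n" "j \<le> n" "w \<in> dominated_words ((n + 1) div 2)"
      "v = assemble n c i j w"
      by (metis dominated_word_assemble)
    then show "v \<in> (\<lambda>(c, i, j, w). assemble n c i j w) ` ?P"
      by (intro image_eqI[of _ _ "(c, i, j, w)"]) auto
  qed
  then have "card (dominated_words n) \<le> card ?P"
    by (intro surj_card_le) (simp_all add: finite_dominated_words)
  then show ?thesis by (simp add: card_cartesian_product power2_eq_square algebra_simps)
qed

lemma card_dominated_words_pos: "card (dominated_words n) > 0"
  using finite_dominated_words[of n] dominated_words_nonempty[of n] by (simp add: card_gt_0_iff)

lemma ln_card_dominated_words: "ln (card (dominated_words n)) \<le> 40 * sqrt n"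
proof (induction n rule: less_induct)
  case (less n)
  consider "n = 0" | "n = 1" | "n \<ge> 2" by linarith
  then show ?case
  proof cases
    case 1
    have "dominated_words 0 = {[]}" using dominated_thue_morse by (auto simp: dominated_words_def)
    then show ?thesis using 1 by simp
  next
    case 2
    have "dominated_words 1 \<subseteq> {[True], [False]}" by (auto simp: dominated_words_def)
    from card_mono[OF _ this] have "card (dominated_words 1) \<le> 2" by simp
    then have "ln (card (dominated_words 1)) \<le> ln 2"
      using card_dominated_words_pos[of 1] by (subst ln_le_cancel_iff) auto
    then show ?thesis using 2 ln_2_less_1 by simp
  next
    case 3
    define m where "m = (n + 1) div 2"
    have m: "m < n" "2 * m \<le> n + 1" using 3 unfolding m_def by linarith+
    from m(2) have m': "2 * real m \<le> real n + 1" by linarith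
    let ?q = "\<lambda>n. real (card (dominated_words n))"
    have pos: "?q k > 0" for k using card_dominated_words_pos by simp
    have "?q n \<le> 2 * (real n + 1)\<^sup>2 * ?q m"
      using card_dominated_words_half[of n] unfolding m_def[symmetric]
      by (metis (mono_tags, lifting) of_nat_1 of_nat_add of_nat_le_iff of_nat_mult of_nat_numeral
          of_nat_power)
    then have "ln (?q n) \<le> ln (2 * (real n + 1)\<^sup>2 * ?q m)"
      using pos by (subst ln_le_cancel_iff) auto
    also have "\<dots> = ln 2 + 2 * ln (real n + 1) + ln (?q m)"
      using pos[of m] by (simp add: ln_mult ln_realpow)
    \<comment> \<open>For \<open>n \<ge> 2\<close>,
      \<open>m \<le> (n + 1) / 2 \<le> 3/4 * n \<le> (7/8)^2 * n\<close>. The constant 40 leaves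
      \<open>40 / 8 = 5\<close> multiples of \<open>sqrt n\<close> to absorb
      \<open>1 + 4 * sqrt n\<close>.\<close>
    also have "\<dots> \<le> 1 + 4 * sqrt n + 40 * (7 / 8 * sqrt n)"
    proof -
      have "real n + 1 \<le> (1 + sqrt n)\<^sup>2" by (simp add: power2_sum)
      then have "ln (real n + 1) \<le> ln ((1 + sqrt n)\<^sup>2)"
        by (subst ln_le_cancel_iff) (auto intro!: zero_less_power add_pos_nonneg)
      also have "\<dots> = 2 * ln (1 + sqrt n)" by (subst ln_realpow) (auto intro!: add_pos_nonneg)
      also have "\<dots> \<le> 2 * sqrt n" using ln_add_one_self_le_self[of "sqrt n"] by simp
      finally have 1: "ln (real n + 1) \<le> 2 * sqrt n" .
      have "sqrt m \<le> sqrt ((7 / 8)\<^sup>2 * n)" using m' 3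
        by (intro real_sqrt_le_mono) (simp add: power2_eq_square)
      then have 2: "sqrt m \<le> 7 / 8 * sqrt n" by (simp add: real_sqrt_mult)
      show ?thesis using 1 2 less.IH[OF m(1)] ln_2_less_1 by linarith
    qed
    also have "\<dots> \<le> 40 * sqrt n" using 3 by (simp add: real_le_rsqrt)
    finally show ?thesis .
  qed
qed

section \<open>Parity itineraries of unimodal maps\<close>

text \<open>For a map \<open>f\<close> increasing up to \<open>1/2\<close> and decreasing afterwards, \<open>parity f x k\<close> says that
  \<open>f ^^ k\<close> reverses the orientation near \<open>x\<close>.\<close>

primrec parity :: "(real \<Rightarrow> real) \<Rightarrow> real \<Rightarrow> nat \<Rightarrow> bool" where
  "parity f x 0 = False"
| "parity f x (Suc k) = (parity f x k \<noteq> ((f ^^ k) x \<ge> 1/2))"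

lemma parity_shift: "parity f ((f ^^ k) x) = fold_shift k (parity f x)"
proof
  fix i show "parity f ((f ^^ k) x) i = fold_shift k (parity f x) i"
    by (induction i) (auto simp: fold_shift_def funpow_add[symmetric, THEN fun_cong, simplified]
        add.commute)
qed

definition unimodal :: "(real \<Rightarrow> real) \<Rightarrow> bool" where
  "unimodal f \<longleftrightarrow> mono_on {..1/2} f \<and> antimono_on {1/2..} f"

text \<open>Equal parities up to \<open>k\<close> keep both orbits on the same monotone branch
  before time \<open>k\<close>, and the parity counts the order reversals.\<close>

lemma parity_orientation:
  assumes "unimodal f" "x \<le> y" "\<forall>i\<le>k. parity f x i = parity f y i"
  shows "if parity f x k then (f ^^ k) y \<le> (f ^^ k) x else (f ^^ k) x \<le> (f ^^ k) y"
  using assms(3)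
proof (induction k)
  case 0
  then show ?case using assms by simp
next
  case (Suc k)
  have side: "((f ^^ k) x \<ge> 1/2) = ((f ^^ k) y \<ge> 1/2)"
    using Suc.prems[rule_format, of "Suc k"] Suc.prems[rule_format, of k] by auto
  have up: "f a \<le> f b" if "a \<le> b" "\<not> b \<ge> 1/2" for a b
    using assms(1) that unfolding unimodal_def by (auto simp: monotone_on_def)
  have down: "f b \<le> f a" if "a \<le> b" "a \<ge> 1/2" for a b
    using assms(1) that unfolding unimodal_def by (auto simp: monotone_on_def)
  show ?case
    using Suc.IH Suc.prems side up down by (auto split: if_splits)
qed

text \<open>After equal parities the order of the two iterates is known. Whether it is kept or
  reversed, if the next parity of \<open>x\<close> is true, that order forces \<open>y\<close> onto
  the same side of \<open>1/2\<close>.\<close>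

lemma parity_lex_mono:
  assumes "unimodal f" "x \<le> y"
  shows "lex_le (parity f x) (parity f y)"
  unfolding lex_le_def
proof (intro allI impI)
  fix k assume agree: "\<forall>i<k. parity f x i = parity f y i" and "parity f x k"
  then obtain m where k: "k = Suc m" by (cases k) auto
  then show "parity f y k"
    using parity_orientation[OF assms, of m] agree \<open>parity f x k\<close>
    by (auto split: if_splits simp: less_Suc_eq_le)
qed

text \<open>On points with the same parity itinerary all iterates are monotone, so the value of one
  alternating sum determines every summand.\<close>

lemma spanning_number_le_words:
  assumes f: "unimodal f" "f ` {0..1} \<subseteq> {0..1}"
    and words: "\<And>x. x \<in> {0..1} \<Longrightarrow> map (\<lambda>i. parity f x (Suc i)) [0..<n] \<in> W" "finite W"
    and N: "N > 0" "1 / real N < \<epsilon>"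
  shows "spanning_number {0..1} f n \<epsilon> \<le> card W * (2 * n * N + 1)"
proof -
  \<comment> \<open>Rounding to cells of length \<open>1 / N\<close> makes the sum an integer
    between \<open>- n * N\<close> and \<open>n * N\<close>, which leaves
    \<open>2 * n * N + 1\<close> values.\<close>
  define S where
    "S x = (\<Sum>k<n. (if parity f x k then -1 else 1) * \<lfloor>real N * (f ^^ k) x\<rfloor>)" for x
  define \<Psi> where "\<Psi> x = (map (\<lambda>i. parity f x (Suc i)) [0..<n], S x)" for x
  have orbit: "(f ^^ k) x \<in> {0..1}" if "x \<in> {0..1}" for x k
    using f(2) that by (induction k) (auto simp: image_subset_iff)
  have floor: "\<bar>\<lfloor>real N * (f ^^ k) x\<rfloor>\<bar> \<le> int N" if "x \<in> {0..1}" for x k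
  proof -
    have "0 \<le> real N * (f ^^ k) x" "real N * (f ^^ k) x \<le> real N"
      using orbit[OF that, of k] by (auto simp: mult_left_le)
    then have "0 \<le> \<lfloor>real N * (f ^^ k) x\<rfloor>" "\<lfloor>real N * (f ^^ k) x\<rfloor> \<le> int N"
      by (simp, linarith)
    then show ?thesis by simp
  qed
  have S_bound: "\<bar>S x\<bar> \<le> int (n * N)" if "x \<in> {0..1}" for x
  proof -
    have "\<bar>S x\<bar> \<le> (\<Sum>k<n. \<bar>(if parity f x k then -1 else 1) * \<lfloor>real N * (f ^^ k) x\<rfloor>\<bar>)"
      unfolding S_def by (rule sum_abs)
    also have "\<dots> \<le> (\<Sum>k<n. int N)"
      using floor[OF that] by (intro sum_mono) (simp add: abs_mult)
    finally show ?thesis by simp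
  qed
  have "\<Psi> ` {0..1} \<subseteq> W \<times> {- int (n * N)..int (n * N)}" (is "_ \<subseteq> ?R")
    using words(1) S_bound by (fastforce simp: \<Psi>_def abs_le_iff)
  moreover have finR: "finite ?R" using words(2) by simp
  ultimately have fin: "finite (\<Psi> ` {0..1})" and card: "card (\<Psi> ` {0..1}) \<le> card ?R"
    by (auto intro: finite_subset card_mono)
  have close': "dist ((f ^^ k) x) ((f ^^ k) y) < \<epsilon>"
    if "\<Psi> x = \<Psi> y" "x \<le> y" "k < n" for x y k
  proof -
    have parity: "parity f x i = parity f y i" if "i \<le> n" for i
      using that \<open>\<Psi> x = \<Psi> y\<close> by (cases i) (auto simp: \<Psi>_def)
    \<comment> \<open>For \<open>x \<le> y\<close> all signed differences are nonnegative, so equal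
      sums force each to vanish and both iterates share a cell.\<close>
    define D where "D k = (if parity f x k then -1 else 1) *
      (\<lfloor>real N * (f ^^ k) y\<rfloor> - \<lfloor>real N * (f ^^ k) x\<rfloor>)" for k
    have "(\<Sum>k<n. D k) = S y - S x"
      unfolding S_def D_def sum_subtractf[symmetric]
      by (intro sum.cong) (auto simp: parity algebra_simps)
    then have "(\<Sum>k<n. D k) = 0" using that(1) by (simp add: \<Psi>_def)
    moreover have "D k \<ge> 0" if "k < n" for k
      using parity_orientation[OF f(1) \<open>x \<le> y\<close>, of k] parity that
      by (auto simp: D_def intro!: floor_mono mult_left_mono split: if_splits)
    ultimately have "D k = 0" using \<open>k < n\<close> by (subst (asm) sum_nonneg_eq_0_iff) auto
    then have "\<lfloor>real N * (f ^^ k) y\<rfloor> = \<lfloor>real N * (f ^^ k) x\<rfloor>"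
      by (auto simp: D_def split: if_splits)
    then have "\<bar>real N * (f ^^ k) x - real N * (f ^^ k) y\<bar> < 1" by linarith
    then have "\<bar>(f ^^ k) x - (f ^^ k) y\<bar> < 1 / real N"
      using N(1) by (simp add: right_diff_distrib[symmetric] abs_mult pos_less_divide_eq mult.commute)
    then show ?thesis using N by (simp add: dist_real_def)
  qed
  have close: "dist ((f ^^ k) x) ((f ^^ k) y) < \<epsilon>" if "\<Psi> x = \<Psi> y" "k < n" for x y k
    using close'[of x y k] close'[of y x k] that by (cases "x \<le> y") (auto simp: dist_commute)
  \<comment> \<open>One representative is chosen from each fibre of \<open>\<Psi>\<close>.\<close>
  obtain F where F: "F \<subseteq> {0..1}" "inj_on \<Psi> F" "\<Psi> ` F = \<Psi> ` {0..1}"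
    by (metis subset_image_inj order_refl)
  then have "finite F" "card F \<le> card ?R"
    using fin card by (metis finite_imageD, metis card_image)
  moreover have "spanning_set {0..1} f n \<epsilon> F"
    unfolding spanning_set_def
  proof (intro conjI ballI)
    fix x :: real assume "x \<in> {0..1}"
    then have "\<Psi> x \<in> \<Psi> ` F" unfolding F(3) by (rule imageI)
    then obtain y where "y \<in> F" "\<Psi> x = \<Psi> y" by blast
    then show "\<exists>y\<in>F. \<forall>k<n. dist ((f ^^ k) x) ((f ^^ k) y) < \<epsilon>" using close by blast
  qed (rule F)
  ultimately have "spanning_number {0..1} f n \<epsilon> \<le> card F"
    unfolding spanning_number_def by (intro cInf_lower) auto
  also have "\<dots> \<le> card ?R" by fact
  also have "card {- int (n * N)..int (n * N)} = 2 * n * N + 1"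
    by (simp add: nat_eq_iff)
  then have "card ?R = card W * (2 * n * N + 1)"
    by (simp add: card_cartesian_product)
  finally show ?thesis .
qed

lemma topological_entropy_eq_0:
  assumes f: "unimodal f" "f ` {0..1} \<subseteq> {0..1}"
    and dom: "\<And>x. x \<in> {0..1} \<Longrightarrow> dominated (\<lambda>i. parity f x (Suc i))"
  shows "topological_entropy {0..1} f = 0"
proof -
  have "(\<lambda>n. ln (real (spanning_number {0..1} f n \<epsilon>)) / real n) \<longlonglongrightarrow> 0" if \<epsilon>: "\<epsilon> > 0" for \<epsilon>
  proof -
    obtain N :: nat where N: "N > 0" "1 / real N < \<epsilon>"
      using \<epsilon> by (metis nat_approx_posE zero_less_Suc)
    let ?s = "\<lambda>n. real (spanning_number {0..1} f n \<epsilon>)"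
    \<comment> \<open>For the value 0 this is the convention \<open>ln 0 = 0\<close>.\<close>
    have ln_nonneg: "ln (?s n) \<ge> 0" for n
      by (cases "spanning_number {0..1} f n \<epsilon>") auto
    have "ln (?s n) \<le> 40 * sqrt n + ln (2 * real n * real N + 1)" for n
    proof (cases "?s n = 0")
      case False
      have "spanning_number {0..1} f n \<epsilon> \<le> card (dominated_words n) * (2 * n * N + 1)"
        by (rule spanning_number_le_words[OF f _ finite_dominated_words N])
           (use dom in \<open>auto simp: dominated_words_def simp del: parity.simps\<close>)
      then have "?s n \<le> real (card (dominated_words n) * (2 * n * N + 1))"
        by (simp only: of_nat_le_iff)
      also have "\<dots> = real (card (dominated_words n)) * (2 * real n * real N + 1)"
        by (simp add: algebra_simps)
      finally have "ln (?s n) \<le> ln (real (card (dominated_words n)) * (2 * real n * real N + 1))"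
        using False by simp
      also have "\<dots> = ln (card (dominated_words n)) + ln (2 * real n * real N + 1)"
        using card_dominated_words_pos[of n] add_nonneg_pos[of "2 * real n * real N" 1]
        by (simp add: ln_mult)
      finally show ?thesis using ln_card_dominated_words[of n] by linarith
    qed (auto intro!: add_nonneg_nonneg)
    then have upper: "ln (?s n) / n \<le> (40 * sqrt n + ln (2 * real n * real N + 1)) / n" for n
      by (intro divide_right_mono) auto
    have lower: "0 \<le> ln (?s n) / n" for n
      using ln_nonneg[of n] by simp
    have lim: "(\<lambda>n. (40 * sqrt n + ln (2 * real n * real N + 1)) / n) \<longlonglongrightarrow> 0"
      using N(1) by real_asymp
    show ?thesis
      by (rule tendsto_sandwich[OF always_eventually always_eventually tendsto_const lim])
         (use lower upper in blast)+
  qed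
  then have "(\<lambda>n. ereal (ln (real (spanning_number {0..1} f n \<epsilon>)) / real n)) \<longlonglongrightarrow> 0"
    if "\<epsilon> > 0" for \<epsilon>
    using that by (simp add: zero_ereal_def)
  then have "limsup (\<lambda>n. ereal (ln (real (spanning_number {0..1} f n \<epsilon>)) / real n)) = 0"
    if "\<epsilon> > 0" for \<epsilon>
    using that by (intro lim_imp_Limsup) auto
  then have "topological_entropy {0..1} f = (SUP \<epsilon>\<in>{0::real<..}. 0)"
    unfolding topological_entropy_def by (intro SUP_cong) auto
  then show ?thesis by (simp add: exI[of _ "1 :: real"])
qed

section \<open>Binary expansions and the tent map\<close>

text \<open>Digit 0 has weight 1, so values fill \<open>[0, 2]\<close>, and sequences starting with
  \<open>False\<close> represent points of \<open>[0, 1]\<close>.\<close>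

definition binval :: "(nat \<Rightarrow> bool) \<Rightarrow> real" where
  "binval s = (\<Sum>i. of_bool (s i) / 2 ^ i)"

lemma summable_binval: "summable (\<lambda>i. of_bool (s i) / 2 ^ i :: real)"
  by (rule summable_comparison_test'[OF summable_geometric[of "1 / 2 :: real"], where N = 0])
     (auto simp: power_divide)

lemma binval_nonneg: "0 \<le> binval s"
  unfolding binval_def by (intro suminf_nonneg summable_binval) auto

lemma binval_complement: "binval (\<lambda>i. \<not> s i) = 2 - binval s"
proof -
  have "binval (\<lambda>i. \<not> s i) + binval s = (\<Sum>i. (1 / 2) ^ i)"
    unfolding binval_def suminf_add[OF summable_binval summable_binval]
    by (intro suminf_cong) (auto simp: power_divide)
  then show ?thesis by (simp add: suminf_geometric)
qed

lemma binval_le_2: "binval s \<le> 2"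
  using binval_complement[of s] binval_nonneg[of "\<lambda>i. \<not> s i"] by simp

lemma binval_split:
  "binval s = (\<Sum>i<k. of_bool (s i) / 2 ^ i) + binval (\<lambda>i. s (k + i)) / 2 ^ k"
  unfolding binval_def suminf_split_initial_segment[OF summable_binval, of s k]
    suminf_divide[OF summable_binval, symmetric]
  by (simp add: power_add add.commute[of k] mult.commute)

lemma binval_0: "binval s = of_bool (s 0) + binval (\<lambda>i. s (Suc i)) / 2"
  using binval_split[of s 1] by simp

lemma binval_prefix:
  assumes "\<forall>i<k. s i = t i"
  shows "\<bar>binval s - binval t\<bar> \<le> 2 / 2 ^ k"
proof -
  have "binval s - binval t = (binval (\<lambda>i. s (k + i)) - binval (\<lambda>i. t (k + i))) / 2 ^ k"
    using assms binval_split[of s k] binval_split[of t k] by (simp add: diff_divide_distrib)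
  also have "\<bar>\<dots>\<bar> \<le> 2 / 2 ^ k"
    using binval_nonneg[of "\<lambda>i. s (k + i)"] binval_nonneg[of "\<lambda>i. t (k + i)"]
      binval_le_2[of "\<lambda>i. s (k + i)"] binval_le_2[of "\<lambda>i. t (k + i)"]
    by (simp add: divide_right_mono)
  finally show ?thesis .
qed

text \<open>At the first difference the tail of \<open>s\<close> is at most 0.111... = 1, and that
  of \<open>t\<close> is at least 1.\<close>

lemma binval_mono:
  assumes "lex_le s t"
  shows "binval s \<le> binval t"
proof (cases "s = t")
  case False
  define k where "k = (LEAST k. s k \<noteq> t k)"
  have "s k \<noteq> t k" unfolding k_def by (rule LeastI_ex[of "\<lambda>k. s k \<noteq> t k"]) (use False in auto)
  moreover have agree: "\<forall>i<k. s i = t i" using not_less_Least unfolding k_def by blast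
  ultimately have k: "\<not> s k" "t k" using assms unfolding lex_le_def by blast+
  have "binval (\<lambda>i. s (k + i)) \<le> 1"
    using k binval_0[of "\<lambda>i. s (k + i)"] binval_le_2[of "\<lambda>i. s (k + Suc i)"] by simp
  also have "1 \<le> binval (\<lambda>i. t (k + i))"
    using k binval_0[of "\<lambda>i. t (k + i)"] binval_nonneg[of "\<lambda>i. t (k + Suc i)"] by simp
  finally have "binval (\<lambda>i. s (k + i)) / 2 ^ k \<le> binval (\<lambda>i. t (k + i)) / 2 ^ k"
    by (simp add: divide_right_mono)
  moreover have "(\<Sum>i<k. of_bool (s i) / 2 ^ i :: real) = (\<Sum>i<k. of_bool (t i) / 2 ^ i)"
    using agree by (intro sum.cong) auto
  ultimately show ?thesis
    using binval_split[of s k] binval_split[of t k] by linarith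
qed simp

text \<open>Doubling shifts the digits, and the reflection on the right half complements them. The
  inequalities are weak because \<open>1/2\<close> has two expansions.\<close>

lemma tent_binval:
  assumes "\<not> s 0"
  shows "1 - \<bar>1 - 2 * binval s\<bar> = binval (fold_shift 1 s)"
    and "s 1 \<Longrightarrow> 1/2 \<le> binval s" and "\<not> s 1 \<Longrightarrow> binval s \<le> 1/2"
proof -
  let ?t = "\<lambda>i. s (Suc i)"
  have s: "binval s = binval ?t / 2" using assms binval_0[of s] by simp
  note t = binval_0[of ?t] binval_nonneg[of "\<lambda>i. ?t (Suc i)"] binval_le_2[of "\<lambda>i. ?t (Suc i)"]
  show "1/2 \<le> binval s" if "s 1" using s t that by simp
  show "binval s \<le> 1/2" if "\<not> s 1" using s t that by simp
  show "1 - \<bar>1 - 2 * binval s\<bar> = binval (fold_shift 1 s)"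
  proof (cases "s 1")
    case True
    then have "fold_shift 1 s = (\<lambda>i. \<not> ?t i)" by (auto simp: fold_shift_def)
    then show ?thesis using True s t binval_complement[of ?t] by simp
  next
    case False
    then have "fold_shift 1 s = ?t" by (auto simp: fold_shift_def)
    then show ?thesis using False s t by simp
  qed
qed

section \<open>The truncated tent map\<close>

definition height :: real where "height = binval thue_morse"

definition trapezoid :: "real \<Rightarrow> real" where
  "trapezoid x = min height (1 - \<bar>1 - 2 * x\<bar>)"

lemma height_bounds: "0 \<le> height" "height < 1"
proof -
  show "0 \<le> height" by (simp add: height_def binval_nonneg)
  \<comment> \<open>The digits 0110 contribute \<open>3/4\<close> and the tail at most
    \<open>2/16\<close>.\<close>
  have "{..<4::nat} = {0, 1, 2, 3}" by auto
  then show "height < 1"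
    using binval_split[of thue_morse 4] binval_le_2[of "\<lambda>i. thue_morse (4 + i)"]
    by (simp add: height_def)
qed

lemma continuous_trapezoid: "continuous_on A trapezoid"
  unfolding trapezoid_def by (intro continuous_intros)

lemma continuous_trapezoid_iter: "continuous_on UNIV (trapezoid ^^ n)"
  by (induction n)
     (auto simp: id_def intro: continuous_on_compose2[OF continuous_trapezoid[of UNIV]])

lemma trapezoid_maps: "trapezoid ` {0..1} \<subseteq> {0..1}"
  using height_bounds by (auto simp: trapezoid_def min_def)

lemma unimodal_trapezoid: "unimodal trapezoid"
  unfolding unimodal_def trapezoid_def by (auto simp: monotone_on_def min_def)

text \<open>Domination bounds every tent image along the orbit by \<open>height\<close>, so the
  truncation never changes a value.\<close>

lemma trapezoid_orbit: "(trapezoid ^^ k) height = binval (fold_shift k thue_morse)"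
proof (induction k)
  case 0
  have "fold_shift 0 thue_morse = thue_morse" by (auto simp: fold_shift_def)
  then show ?case by (simp add: height_def)
next
  case (Suc k)
  have "binval (fold_shift (Suc k) thue_morse) \<le> height"
    unfolding height_def using dominated_thue_morse by (intro binval_mono) (simp add: dominated_def)
  then show ?case
    using Suc tent_binval(1)[of "fold_shift k thue_morse"]
    by (simp add: trapezoid_def fold_shift_fold_shift)
qed

lemma orbit_outside_plateau: "1 - \<bar>1 - 2 * (trapezoid ^^ k) height\<bar> \<le> height"
proof -
  have "binval (fold_shift (Suc k) thue_morse) \<le> height"
    unfolding height_def using dominated_thue_morse by (intro binval_mono) (simp add: dominated_def)
  then show ?thesis
    using tent_binval(1)[of "fold_shift k thue_morse"]
    by (simp add: trapezoid_orbit fold_shift_fold_shift)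
qed

lemma orbit_side: "(trapezoid ^^ k) height \<ge> 1/2 \<longleftrightarrow> thue_morse k \<noteq> thue_morse (Suc k)"
proof -
  have side: "fold_shift k thue_morse 1 = (thue_morse k \<noteq> thue_morse (Suc k))"
    by (auto simp: fold_shift_def)
  \<comment> \<open>The ambiguous point \<open>1/2\<close> is excluded because its tent image 1
    exceeds \<open>height\<close>.\<close>
  have "(trapezoid ^^ k) height \<noteq> 1/2"
    using orbit_outside_plateau[of k] height_bounds(2) by auto
  then show ?thesis
    using tent_binval(2,3)[of "fold_shift k thue_morse"]
    unfolding trapezoid_orbit side by fastforce
qed

lemma parity_height: "parity trapezoid height = thue_morse"
proof
  fix k show "parity trapezoid height k = thue_morse k"
  proof (induction k)
    case (Suc k)
    then show ?case using orbit_side[of k] unfolding parity.simps by blast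
  qed simp
qed

text \<open>All iterates from the first on are at most \<open>height\<close>, whose parities form
  the Thue-Morse sequence. The starting point may be larger, hence the shift by one.\<close>

lemma dominated_parity: "dominated (\<lambda>i. parity trapezoid x (Suc i))"
  unfolding dominated_def
proof
  fix k
  have "(trapezoid ^^ Suc k) x \<le> height" by (simp add: trapezoid_def)
  then have "lex_le (fold_shift (Suc k) (parity trapezoid x)) thue_morse"
    unfolding parity_shift[symmetric] parity_height[symmetric]
    by (rule parity_lex_mono[OF unimodal_trapezoid])
  then show "lex_le (fold_shift k (\<lambda>i. parity trapezoid x (Suc i))) thue_morse"
    by (simp add: fold_shift_def[abs_def] del: parity.simps)
qed

text \<open>The block of length \<open>2 ^ j\<close> at place \<open>3 * 2 ^ j\<close> repeats the
  initial block, so the digits of that iterate agree with those of \<open>height\<close> up to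
  \<open>2 ^ j\<close>. Continuity gives the case of general \<open>n\<close>.\<close>

lemma height_recurrent: "(\<lambda>j. (trapezoid ^^ (n + 3 * 2 ^ j)) height) \<longlonglongrightarrow> (trapezoid ^^ n) height"
proof -
  have "(\<lambda>j. (trapezoid ^^ (3 * 2 ^ j)) height) \<longlonglongrightarrow> height"
  proof (rule LIMSEQ_I)
    have bound: "\<bar>(trapezoid ^^ (3 * 2 ^ j)) height - height\<bar> \<le> 2 / 2 ^ (2 ^ j)" for j
      unfolding trapezoid_orbit unfolding height_def
    proof (rule binval_prefix, intro allI impI)
      fix i :: nat assume "i < 2 ^ j"
      then show "fold_shift (3 * 2 ^ j) thue_morse i = thue_morse i"
        using thue_morse_block[of i j 3] thue_morse_block[of 0 j 3] by (auto simp: fold_shift_def)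
    qed
    fix r :: real assume "r > 0"
    have "(\<lambda>j. 2 / 2 ^ j :: real) \<longlonglongrightarrow> 0" by real_asymp
    then obtain M where M: "\<And>j. j \<ge> M \<Longrightarrow> 2 / 2 ^ j < r"
      using \<open>r > 0\<close> unfolding LIMSEQ_iff by fastforce
    have "2 / 2 ^ (2 ^ j) < r" if "j \<ge> M" for j
      using that less_exp[of j] by (intro M) linarith
    with bound show "\<exists>M. \<forall>j\<ge>M. norm ((trapezoid ^^ (3 * 2 ^ j)) height - height) < r"
      by (intro exI[of _ M]) (fastforce intro: le_less_trans)
  qed
  moreover have "isCont (trapezoid ^^ n) height"
    using continuous_trapezoid_iter continuous_on_eq_continuous_at open_UNIV by blast
  ultimately have "(\<lambda>j. (trapezoid ^^ n) ((trapezoid ^^ (3 * 2 ^ j)) height))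
    \<longlonglongrightarrow> (trapezoid ^^ n) height"
    by (rule isCont_tendsto_compose[rotated])
  then show ?thesis by (simp add: funpow_add)
qed

text \<open>A coincidence would make the sides of \<open>1/2\<close>, and with them the changes of
  the Thue-Morse sequence, periodic from \<open>i\<close> on.\<close>

lemma orbit_not_periodic:
  assumes "k > 0"
  shows "(trapezoid ^^ (i + k)) height \<noteq> (trapezoid ^^ i) height"
proof
  assume eq: "(trapezoid ^^ (i + k)) height = (trapezoid ^^ i) height"
  obtain n where n: "n \<ge> i" "((trapezoid ^^ n) height \<ge> 1/2) \<noteq> ((trapezoid ^^ (n + k)) height \<ge> 1/2)"
    using thue_morse_not_eventually_periodic[OF assms, of i] unfolding orbit_side by blast
  have "(trapezoid ^^ (n + k)) height = (trapezoid ^^ (n - i)) ((trapezoid ^^ (i + k)) height)"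
    using n(1) by (simp flip: funpow_add[THEN fun_cong, simplified comp_apply])
  also have "\<dots> = (trapezoid ^^ n) height"
    unfolding eq using n(1) by (simp flip: funpow_add[THEN fun_cong, simplified comp_apply])
  finally show False using n(2) by simp
qed

section \<open>The chaotic orbit closure\<close>

definition orbit_closure :: "real set" where
  "orbit_closure = closure (range (\<lambda>n. (trapezoid ^^ n) height))"

lemma orbit_in_closure: "(trapezoid ^^ n) height \<in> orbit_closure"
  unfolding orbit_closure_def by (meson closure_subset rangeI subsetD)

lemma orbit_closure_outside_plateau:
  assumes "x \<in> orbit_closure"
  shows "1 - \<bar>1 - 2 * x\<bar> \<le> height"
proof -
  have "closed {x. 1 - \<bar>1 - 2 * x\<bar> \<le> height}"
    by (intro closed_Collect_le continuous_intros)
  then have "orbit_closure \<subseteq> {x. 1 - \<bar>1 - 2 * x\<bar> \<le> height}"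
    unfolding orbit_closure_def using orbit_outside_plateau by (intro closure_minimal) auto
  with assms show ?thesis by blast
qed

lemma orbit_closure_unit: "orbit_closure \<subseteq> {0..1}"
proof -
  have "(trapezoid ^^ n) height \<in> {0..1}" for n
    using height_bounds trapezoid_maps by (induction n) (auto simp: image_subset_iff)
  then show ?thesis unfolding orbit_closure_def by (intro closure_minimal) auto
qed

lemma orbit_closure_invariant: "trapezoid ` orbit_closure \<subseteq> orbit_closure"
proof -
  have "trapezoid ((trapezoid ^^ n) height) \<in> orbit_closure" for n
    using orbit_in_closure[of "Suc n"] by simp
  then show ?thesis
    unfolding orbit_closure_def
    by (intro image_closure_subset continuous_trapezoid) auto
qed

lemma orbit_returns:
  assumes "openin (top_of_set orbit_closure) U" "U \<noteq> {}"
  obtains i where "(trapezoid ^^ i) height \<in> U"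
    "\<forall>\<^sub>F j in sequentially. (trapezoid ^^ (i + 3 * 2 ^ j)) height \<in> U"
proof -
  obtain G where G: "open G" "U = orbit_closure \<inter> G" using assms(1) by (auto simp: openin_open)
  then have "G \<inter> range (\<lambda>n. (trapezoid ^^ n) height) \<noteq> {}"
    using assms(2) open_Int_closure_eq_empty[OF G(1)] unfolding orbit_closure_def by blast
  then obtain i where i: "(trapezoid ^^ i) height \<in> G" by blast
  have "\<forall>\<^sub>F j in sequentially. (trapezoid ^^ (i + 3 * 2 ^ j)) height \<in> G"
    by (rule topological_tendstoD[OF height_recurrent G(1) i])
  then show thesis using that[of i] i G(2) orbit_in_closure by simp
qed

lemma transitive_orbit_closure: "transitive_map orbit_closure trapezoid"
  unfolding transitive_map_def
proof (intro allI impI)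
  fix U V assume "openin (top_of_set orbit_closure) U \<and> U \<noteq> {} \<and>
    openin (top_of_set orbit_closure) V \<and> V \<noteq> {}"
  then obtain k i where k: "\<forall>\<^sub>F j in sequentially. (trapezoid ^^ (k + 3 * 2 ^ j)) height \<in> U"
    and i: "(trapezoid ^^ i) height \<in> V"
    by (metis orbit_returns)
  \<comment> \<open>Since \<open>2 ^ j > j \<ge> i\<close>, this visit to \<open>U\<close> comes
    after the visit to \<open>V\<close> at time \<open>i\<close>.\<close>
  obtain j where j: "j \<ge> i" "(trapezoid ^^ (k + 3 * 2 ^ j)) height \<in> U"
    using k unfolding eventually_sequentially by (metis nle_le)
  have "i \<le> k + 3 * 2 ^ j" using j(1) less_exp[of j] by linarith
  then have "(trapezoid ^^ (k + 3 * 2 ^ j - i)) ((trapezoid ^^ i) height) \<in> U"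
    using j(2) by (simp flip: funpow_add[THEN fun_cong, simplified comp_apply])
  with i show "\<exists>n. (trapezoid ^^ n) -` U \<inter> V \<noteq> {}" by blast
qed

text \<open>Distances double as long as two points of the orbit closure stay on the same side of the
  plateau, so they end up on different sides.\<close>

lemma expansive_orbit_closure:
  assumes "x \<in> orbit_closure" "y \<in> orbit_closure" "x \<noteq> y"
  shows "\<exists>n. dist ((trapezoid ^^ n) x) ((trapezoid ^^ n) y) \<ge> 1 - height"
proof (rule ccontr)
  assume "\<not> ?thesis"
  then have near: "\<bar>(trapezoid ^^ n) x - (trapezoid ^^ n) y\<bar> < 1 - height" for n
    by (auto simp: dist_real_def not_le)
  have inY: "(trapezoid ^^ n) z \<in> orbit_closure" if "z \<in> orbit_closure" for n z
    using orbit_closure_invariant that by (induction n) auto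
  have "\<bar>(trapezoid ^^ n) x - (trapezoid ^^ n) y\<bar> = 2 ^ n * \<bar>x - y\<bar>" for n
  proof (induction n)
    case (Suc n)
    \<comment> \<open>The plateau is the interval from \<open>height / 2\<close> to
      \<open>1 - height / 2\<close>. Points outside its interior closer than its length
      \<open>1 - height\<close> lie on one branch, where the slope is 2 or -2.\<close>
    have double: "\<bar>trapezoid a - trapezoid b\<bar> = 2 * \<bar>a - b\<bar>"
      if "a \<in> orbit_closure" "b \<in> orbit_closure" "\<bar>a - b\<bar> < 1 - height" for a b
      using that(3) orbit_closure_outside_plateau[OF that(1)]
        orbit_closure_outside_plateau[OF that(2)]
      unfolding trapezoid_def min_def by (simp add: abs_if split: if_splits)
    show ?case using double[OF inY[OF assms(1)] inY[OF assms(2)] near] Suc by simp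
  qed simp
  with near have "2 ^ n * \<bar>x - y\<bar> < 1" for n
    using height_bounds(1) by (smt (verit, best))
  moreover obtain n where "1 / \<bar>x - y\<bar> < 2 ^ n"
    using real_arch_pow[of 2] by auto
  then have "1 < 2 ^ n * \<bar>x - y\<bar>" using assms(3) by (simp add: field_simps)
  ultimately show False by (meson less_asym)
qed

lemma sensitive_orbit_closure: "sensitive_map orbit_closure trapezoid"
  unfolding sensitive_map_def
proof (intro exI[of _ "1 - height"] conjI ballI allI impI)
  show "0 < 1 - height" using height_bounds by simp
  fix x U assume x: "x \<in> orbit_closure" and U: "openin (top_of_set orbit_closure) U \<and> x \<in> U"
  then obtain i where i: "(trapezoid ^^ i) height \<in> U"
    "\<forall>\<^sub>F j in sequentially. (trapezoid ^^ (i + 3 * 2 ^ j)) height \<in> U"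
    by (metis orbit_returns empty_iff)
  then obtain j where j: "(trapezoid ^^ (i + 3 * 2 ^ j)) height \<in> U"
    unfolding eventually_sequentially by blast
  \<comment> \<open>Recurrence without periodicity puts two distinct points into \<open>U\<close>,
    and one of them differs from \<open>x\<close>.\<close>
  have "(trapezoid ^^ (i + 3 * 2 ^ j)) height \<noteq> (trapezoid ^^ i) height"
    by (rule orbit_not_periodic) simp
  then obtain y where y: "y \<in> U" "y \<noteq> x" using i(1) j by metis
  then have "y \<in> orbit_closure" using U openin_imp_subset by blast
  with x y show "\<exists>y\<in>U. \<exists>n. dist ((trapezoid ^^ n) x) ((trapezoid ^^ n) y) \<ge> 1 - height"
    using expansive_orbit_closure[of x y] by blast
qed

theorem theorem1p6:
  "\<exists>f :: real \<Rightarrow> real.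
     continuous_on {0..1} f \<and> f ` {0..1} \<subseteq> {0..1} \<and>
     topological_entropy {0..1} f = 0 \<and> wiggins_chaotic {0..1} f"
proof (intro exI[of _ trapezoid] conjI)
  show "topological_entropy {0..1} trapezoid = 0"
    by (intro topological_entropy_eq_0 unimodal_trapezoid trapezoid_maps dominated_parity)
  have "closedin (top_of_set {0..1}) orbit_closure"
    using orbit_closure_unit by (simp add: closed_subset orbit_closure_def)
  moreover have "orbit_closure \<noteq> {}" using orbit_in_closure by blast
  ultimately show "wiggins_chaotic {0..1} trapezoid"
    unfolding wiggins_chaotic_def
    using orbit_closure_invariant transitive_orbit_closure sensitive_orbit_closure by blast
qed (rule continuous_trapezoid trapezoid_maps)+

end
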